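(* For $x\in[0,1)\setminus\mathbb Q$ write its continued fraction expansion $x=[a_1(x),a_2(x),\dots]=\cfrac{1}{a_1+\cfrac{1}{a_2+\cdots}}$ with partial quotients $a_n(x)\in\mathbb N$. For $n,\lambda\in\mathbb N$ define $$L_n(x,\lambda)\coloneqq\max_{0\le j\le n-1}\sum_{k=1}^{n-j}\prod_{i=1}^k\mathbf 1_{a_{j+i}(x)=\lambda},\qquad R_n(x)\coloneqq\max_{\lambda\in\mathbb N}L_n(x,\lambda),$$ the length of the longest run of consecutive partial quotients equal to $\lambda$ (resp. equal to a common value) among $a_1(x),\dots,a_n(x)$. Let $\tau(\lambda)\coloneqq\frac{\lambda+\sqrt{\lambda^2+4}}{2}$ and $\varphi\coloneqq\frac{1+\sqrt5}{2}$. Then for every $\lambda\in\mathbb N$, every $c>1/2$ and almost every $x\in[0,1)\setminus\mathbb Q$ (with respect to the Gauss measure, equivalently Lebesgue measure), there exists $n_{c,x}\in\mathbb N$ such that for all $n\ge n_{c,x}$, $$\left|L_n(x,\lambda)-\frac{\log n}{2\log\tau(\lambda)}\right|\le\frac{c\log\log n}{\log\tau(\lambda)}\quad\text{and}\quad\left|R_n(x)-\frac{\log n}{2\log\varphi}\right|\le\frac{c\log\log n}{\log\varphi}.$$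
   Context: The Gauss measure on $[0,1)\setminus\mathbb Q$ is $\mu(A)=\frac1{\log2}\int_A\frac{dx}{1+x}$; it has the same null sets as Lebesgue measure. *)

theory Defs
  imports "HOL-Analysis.Analysis"
begin

section \<open>Continued fractions\<close>

definition gauss_map :: "real \<Rightarrow> real" where
  "gauss_map x = frac (1 / x)"

text \<open>Partial quotients are indexed from 1; the value at index 0 is junk. The digits are computed
  by iterating the Gauss map; the lemmas \<open>cf_conv_cf_digit\<close> and \<open>cf_digit_unique\<close> below show
  that for irrational \<open>x\<close> in the unit interval they are exactly the partial quotients of \<open>x\<close>.\<close>

definition cf_digit :: "nat \<Rightarrow> real \<Rightarrow> nat" where
  "cf_digit n x = nat \<lfloor>1 / (gauss_map ^^ (n - 1)) x\<rfloor>"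

text \<open>\<open>cf_conv a n\<close> is the finite continued fraction \<open>[a 1, \<dots>, a n]\<close>.\<close>

fun cf_conv :: "(nat \<Rightarrow> nat) \<Rightarrow> nat \<Rightarrow> real" where
  "cf_conv a 0 = 0"
| "cf_conv a (Suc n) = 1 / (real (a 1) + cf_conv (\<lambda>k. a (Suc k)) n)"

lemma gauss_map_irrational:
  assumes "x \<in> {0..<1} - \<rat>"
  shows "gauss_map x \<in> {0..<1} - \<rat>"
proof -
  have "gauss_map x \<notin> \<rat>"
  proof
    assume "gauss_map x \<in> \<rat>"
    then have "gauss_map x + of_int \<lfloor>1 / x\<rfloor> \<in> \<rat>" by (intro Rats_add) auto
    then have "1 / x \<in> \<rat>" by (simp add: gauss_map_def frac_def)
    from Rats_divide[OF Rats_1 this] show False using assms by simp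
  qed
  then show ?thesis by (simp add: gauss_map_def frac_lt_1)
qed

lemma cf_digit_Suc:
  "n \<ge> 1 \<Longrightarrow> cf_digit (Suc n) x = cf_digit n (gauss_map x)"
  by (cases n) (simp_all add: cf_digit_def funpow_swap1)

lemma cf_digit_step:
  assumes "x \<in> {0..<1} - \<rat>"
  shows "cf_digit 1 x \<ge> 1" and "x = 1 / (real (cf_digit 1 x) + gauss_map x)"
proof -
  have "x \<noteq> 0" using assms by auto
  then have x: "0 < x" "x < 1" using assms by auto
  then have fl: "1 \<le> \<lfloor>1 / x\<rfloor>" by simp
  then have "nat 1 \<le> nat \<lfloor>1 / x\<rfloor>" by (rule nat_mono)
  then show "cf_digit 1 x \<ge> 1" by (simp add: cf_digit_def del: one_le_floor)
  have "real (cf_digit 1 x) = of_int \<lfloor>1 / x\<rfloor>"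
    unfolding cf_digit_def using fl by (simp del: one_le_floor)
  then show "x = 1 / (real (cf_digit 1 x) + gauss_map x)"
    by (simp add: gauss_map_def frac_def)
qed

lemma cf_digit_pos:
  assumes "x \<in> {0..<1} - \<rat>" "n \<ge> 1"
  shows "cf_digit n x \<ge> 1"
  using assms(2,1)
proof (induction n arbitrary: x rule: dec_induct)
  case base
  then show ?case by (rule cf_digit_step)
next
  case (step n)
  then show ?case using gauss_map_irrational[OF step.prems] by (simp add: cf_digit_Suc)
qed

lemma cf_conv_bounds:
  assumes "\<And>k. k \<ge> 1 \<Longrightarrow> a k \<ge> 1"
  shows "0 \<le> cf_conv a n \<and> cf_conv a n \<le> 1"
  using assms
proof (induction n arbitrary: a)
  case 0
  then show ?case by simp
next
  case (Suc n)
  have "0 \<le> cf_conv (\<lambda>k. a (Suc k)) n" using Suc.IH[of "\<lambda>k. a (Suc k)"] Suc.prems by simp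
  moreover have "1 \<le> real (a 1)" using Suc.prems[of 1] by simp
  ultimately show ?case by simp
qed

lemma cf_conv_cong:
  assumes "\<And>k. k \<ge> 1 \<Longrightarrow> a k = b k"
  shows "cf_conv a n = cf_conv b n"
  using assms
proof (induction n arbitrary: a b)
  case (Suc n)
  have "cf_conv (\<lambda>k. a (Suc k)) n = cf_conv (\<lambda>k. b (Suc k)) n"
    by (rule Suc.IH) (simp add: Suc.prems)
  then show ?case using Suc.prems[of 1] by simp
qed simp

lemma cf_conv_cf_digit_Suc:
  "cf_conv (\<lambda>k. cf_digit k x) (Suc n) =
     1 / (real (cf_digit 1 x) + cf_conv (\<lambda>k. cf_digit k (gauss_map x)) n)"
proof -
  have "cf_conv (\<lambda>k. cf_digit (Suc k) x) n = cf_conv (\<lambda>k. cf_digit k (gauss_map x)) n"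
    by (rule cf_conv_cong) (simp add: cf_digit_Suc)
  then show ?thesis by simp
qed

lemma inverse_shift_diff:
  fixes a s t :: real
  assumes "a \<ge> 1" "s \<ge> 0" "t \<ge> 0"
  shows "\<bar>1 / (a + s) - 1 / (a + t)\<bar> = \<bar>s - t\<bar> / ((a + s) * (a + t))"
proof -
  have "1 / (a + s) - 1 / (a + t) = (t - s) / ((a + s) * (a + t))"
    using assms by (simp add: field_simps)
  then show ?thesis using assms by (simp add: abs_mult abs_minus_commute)
qed

lemma cf_conv_error:
  assumes "x \<in> {0..<1} - \<rat>"
  shows "\<bar>cf_conv (\<lambda>k. cf_digit k x) (2 * n) - x\<bar> \<le> (1 / 4) ^ n
       \<and> \<bar>cf_conv (\<lambda>k. cf_digit k x) (Suc (2 * n)) - x\<bar> \<le> (1 / 4) ^ n"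
proof -
  have two: "\<bar>cf_conv (\<lambda>k. cf_digit k x) (Suc (Suc m)) - x\<bar>
      \<le> \<bar>cf_conv (\<lambda>k. cf_digit k (gauss_map (gauss_map x))) m - gauss_map (gauss_map x)\<bar> / 4"
    if x: "x \<in> {0..<1} - \<rat>" for x m
  proof -
    let ?y = "gauss_map x" let ?z = "gauss_map ?y"
    let ?v = "cf_conv (\<lambda>k. cf_digit k ?z) m"
    define a b where "a = real (cf_digit 1 x)" and "b = real (cf_digit 1 ?y)"
    define s where "s = 1 / (b + ?v)"
    have y: "?y \<in> {0..<1} - \<rat>" using gauss_map_irrational[OF x] .
    have z: "?z \<in> {0..<1} - \<rat>" using gauss_map_irrational[OF y] .
    have ab: "a \<ge> 1" "b \<ge> 1" using cf_digit_step(1)[OF x] cf_digit_step(1)[OF y]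
      by (simp_all add: a_def b_def)
    have v: "?v \<ge> 0" using cf_conv_bounds[of "\<lambda>k. cf_digit k ?z" m] cf_digit_pos[OF z] by simp
    have ye: "?y = 1 / (b + ?z)" using cf_digit_step(2)[OF y] by (simp add: b_def)
    have xe: "x = 1 / (a + ?y)" using cf_digit_step(2)[OF x] by (simp add: a_def)
    have ce: "cf_conv (\<lambda>k. cf_digit k x) (Suc (Suc m)) = 1 / (a + s)"
      by (simp only: cf_conv_cf_digit_Suc a_def b_def s_def)
    have s: "0 \<le> s" "s \<le> 1" using ab v by (simp_all add: s_def)
    have half: "t / (a + t) \<le> 1 / 2" "0 \<le> t / (a + t)" if "0 \<le> t" "t \<le> 1" for t
      using that ab by (simp_all add: field_simps)
    have "\<bar>1 / (a + s) - x\<bar> = \<bar>1 / (a + s) - 1 / (a + ?y)\<bar>" by (subst (1) xe) simp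
    also have "\<dots> = \<bar>s - ?y\<bar> / ((a + s) * (a + ?y))"
      by (rule inverse_shift_diff) (use ab s y in auto)
    also have "\<bar>s - ?y\<bar> = \<bar>?v - ?z\<bar> / ((b + ?v) * (b + ?z))"
      unfolding s_def by (subst (1) ye, rule inverse_shift_diff) (use ab v z in auto)
    also have "\<bar>?v - ?z\<bar> / ((b + ?v) * (b + ?z)) = \<bar>?v - ?z\<bar> * (s * ?y)"
      by (subst (3) ye) (simp add: s_def)
    also have "\<bar>?v - ?z\<bar> * (s * ?y) / ((a + s) * (a + ?y))
        = \<bar>?v - ?z\<bar> * (s / (a + s) * (?y / (a + ?y)))" by simp
    also have "\<dots> \<le> \<bar>?v - ?z\<bar> * (1 / 2 * (1 / 2))"
    proof (intro mult_left_mono mult_mono)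
      show "s / (a + s) \<le> 1 / 2" using half s by blast
      show "?y / (a + ?y) \<le> 1 / 2" "0 \<le> ?y / (a + ?y)" using half[of ?y] y by auto
    qed auto
    finally show ?thesis unfolding ce by simp
  qed
  show ?thesis using assms
  proof (induction n arbitrary: x)
    case 0
    have "0 \<le> cf_conv (\<lambda>k. cf_digit k x) 1 \<and> cf_conv (\<lambda>k. cf_digit k x) 1 \<le> 1"
      by (rule cf_conv_bounds) (rule cf_digit_pos[OF 0])
    moreover have "0 \<le> x" "x \<le> 1" using 0 by auto
    ultimately show ?case by (simp add: abs_le_iff del: cf_conv.simps(2))
  next
    case (Suc n)
    have "gauss_map (gauss_map x) \<in> {0..<1} - \<rat>"
      by (intro gauss_map_irrational Suc.prems)
    from Suc.IH[OF this] two[OF Suc.prems, of "2 * n"] two[OF Suc.prems, of "Suc (2 * n)"]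
    show ?case by (simp del: cf_conv.simps)
  qed
qed

lemma cf_conv_cf_digit:
  assumes "x \<in> {0..<1} - \<rat>"
  shows "(\<lambda>n. cf_conv (\<lambda>k. cf_digit k x) n) \<longlonglongrightarrow> x"
proof -
  have bound: "\<bar>cf_conv (\<lambda>k. cf_digit k x) n - x\<bar> \<le> (1 / 4) ^ (n div 2)" for n
  proof (cases "even n")
    case True
    then show ?thesis using cf_conv_error[OF assms, of "n div 2"] by simp
  next
    case False
    then have "Suc (2 * (n div 2)) = n" by simp
    then show ?thesis using cf_conv_error[OF assms, of "n div 2"] by metis
  qed
  have "filterlim (\<lambda>n::nat. n div 2) sequentially sequentially"
    unfolding filterlim_at_top eventually_sequentially
  proof
    fix Z :: nat
    show "\<exists>N. \<forall>n\<ge>N. Z \<le> n div 2" by (intro exI[of _ "2 * Z"]) auto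
  qed
  moreover have "(\<lambda>n. (1 / 4 :: real) ^ n) \<longlonglongrightarrow> 0" by (rule LIMSEQ_power_zero) simp
  ultimately have "(\<lambda>n. (1 / 4 :: real) ^ (n div 2)) \<longlonglongrightarrow> 0"
    using filterlim_compose by blast
  then have "(\<lambda>n. cf_conv (\<lambda>k. cf_digit k x) n - x) \<longlonglongrightarrow> 0"
    by (rule Lim_null_comparison[rotated]) (use bound in auto)
  then show ?thesis by (rule LIM_zero_cancel)
qed

lemma cf_digit_unique:
  assumes "x \<in> {0..<1} - \<rat>" "\<And>k. k \<ge> 1 \<Longrightarrow> a k \<ge> 1" "(\<lambda>n. cf_conv a n) \<longlonglongrightarrow> x" "n \<ge> 1"
  shows "a n = cf_digit n x"
proof -
  have head: "cf_digit 1 x = a 1 \<and> (\<lambda>n. cf_conv (\<lambda>k. a (Suc k)) n) \<longlonglongrightarrow> gauss_map x"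
    if x: "x \<in> {0..<1} - \<rat>" and a: "\<And>k. k \<ge> 1 \<Longrightarrow> a k \<ge> 1"
      and lim: "(\<lambda>n. cf_conv a n) \<longlonglongrightarrow> x" for x a
  proof -
    let ?c = "\<lambda>n. cf_conv (\<lambda>k. a (Suc k)) n"
    have x0: "x \<noteq> 0" using x by auto
    have bnd: "0 \<le> ?c n \<and> ?c n \<le> 1" for n
      by (rule cf_conv_bounds) (use a in simp)
    have "(\<lambda>n. cf_conv a (Suc n)) \<longlonglongrightarrow> x" using lim by (rule LIMSEQ_Suc)
    then have "(\<lambda>n. 1 / cf_conv a (Suc n) - real (a 1)) \<longlonglongrightarrow> 1 / x - real (a 1)"
      by (intro tendsto_intros x0)
    then have tail: "?c \<longlonglongrightarrow> 1 / x - real (a 1)" by simp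
    have ge: "0 \<le> 1 / x - real (a 1)"
      by (rule LIMSEQ_le_const[OF tail]) (use bnd in auto)
    have le: "1 / x - real (a 1) \<le> 1"
      by (rule LIMSEQ_le_const2[OF tail]) (use bnd in auto)
    have "1 / x - real (a 1) \<noteq> 1"
    proof
      assume "1 / x - real (a 1) = 1"
      then have "1 / x = 1 + real (a 1)" by simp
      then have "x = 1 / (1 + real (a 1))" using x0 by (simp add: field_simps)
      also have "\<dots> \<in> \<rat>" by (intro Rats_divide Rats_add) auto
      finally show False using x by simp
    qed
    with ge le have fl: "\<lfloor>1 / x\<rfloor> = int (a 1)" by (intro floor_unique) auto
    then show ?thesis using tail by (simp add: cf_digit_def gauss_map_def frac_def)
  qed
  show ?thesis using assms(4,1,2,3)
  proof (induction n arbitrary: x a rule: dec_induct)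
    case base
    then show ?case using head[of x a] by simp
  next
    case (step n)
    have "a (Suc n) = cf_digit n (gauss_map x)"
      by (rule step.IH[of "gauss_map x" "\<lambda>k. a (Suc k)"])
        (use step.prems head[of x a] gauss_map_irrational in auto)
    then show ?case using step.hyps by (simp add: cf_digit_Suc)
  qed
qed

section \<open>The Gauss measure\<close>

definition gauss_measure :: "real measure" where
  "gauss_measure =
     density (restrict_space lborel ({0..<1} - \<rat>)) (\<lambda>x. ennreal (1 / (ln 2 * (1 + x))))"

lemma irrational_unit_borel [measurable]: "{0..<1} - \<rat> \<in> sets (borel :: real measure)"
proof -
  have "(\<Union>q\<in>\<rat>. {q}) \<in> sets (borel :: real measure)"
    by (intro sets.countable_UN') (auto intro: countable_rat)
  then show ?thesis by auto
qed

lemma AE_gauss_measure_iff: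
  "(AE x in gauss_measure. P x) \<longleftrightarrow> (AE x in lborel. x \<in> {0..<1} - \<rat> \<longrightarrow> P x)"
proof -
  let ?S = "{0..<1} - \<rat> :: real set"
  let ?M = "restrict_space lborel ?S"
  have meas: "(\<lambda>x. ennreal (1 / (ln 2 * (1 + x)))) \<in> borel_measurable ?M"
    by (rule measurable_restrict_space1) measurable
  have "(AE x in gauss_measure. P x) \<longleftrightarrow> (AE x in ?M. 0 < ennreal (1 / (ln 2 * (1 + x))) \<longrightarrow> P x)"
    unfolding gauss_measure_def by (rule AE_density[OF meas])
  also have "\<dots> \<longleftrightarrow> (AE x in ?M. P x)"
    by (rule AE_cong) (auto simp: space_restrict_space)
  also have "\<dots> \<longleftrightarrow> (AE x in lborel. x \<in> ?S \<longrightarrow> P x)"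
    by (rule AE_restrict_space_iff) simp
  finally show ?thesis .
qed

section \<open>Longest runs of equal partial quotients\<close>

text \<open>At \<open>n = 0\<close> the index set below is \<open>{0}\<close> by truncated subtraction, so \<open>run_length 0 x l = 0\<close>.\<close>

definition run_length :: "nat \<Rightarrow> real \<Rightarrow> nat \<Rightarrow> nat" where
  "run_length n x l =
     Max ((\<lambda>j. \<Sum>k=1..n - j. \<Prod>i=1..k. of_bool (cf_digit (j + i) x = l)) ` {0..n - 1})"

definition max_run_length :: "nat \<Rightarrow> real \<Rightarrow> nat" where
  "max_run_length n x = Max (run_length n x ` {1..})"

lemma run_length_le: "run_length n x l \<le> n"
  unfolding run_length_def
proof (rule Max.boundedI)
  fix y :: nat assume "y \<in> (\<lambda>j. \<Sum>k=1..n - j. \<Prod>i=1..k. of_bool (cf_digit (j + i) x = l)) ` {0..n - 1}"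
  then obtain j where y: "y = (\<Sum>k=1..n - j. \<Prod>i=1..k. of_bool (cf_digit (j + i) x = l))"
    by auto
  also have "\<dots> \<le> (\<Sum>k=1..n - j. 1)"
  proof (rule sum_mono)
    fix k
    have "(\<Prod>i=1..k. of_bool (cf_digit (j + i) x = l)) \<le> (\<Prod>i=1..k. 1 :: nat)"
      by (rule prod_mono) (simp add: of_bool_def)
    then show "(\<Prod>i=1..k. of_bool (cf_digit (j + i) x = l)) \<le> (1 :: nat)" by simp
  qed
  finally show "y \<le> n" by simp
qed auto

text \<open>The maximum in \<open>max_run_length\<close> is over an infinite index set, but of a finite set of values.\<close>

lemma finite_run_lengths: "finite (run_length n x ` {1..})"
  by (rule finite_subset[of _ "{..n}"]) (auto simp: run_length_le)

definition tau :: "nat \<Rightarrow> real" where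
  "tau l = (real l + sqrt ((real l)\<^sup>2 + 4)) / 2"

definition golden_ratio :: real where
  "golden_ratio = (1 + sqrt 5) / 2"

end

theory Submission
  imports Defs "HOL-Real_Asymp.Real_Asymp"
begin

text \<open>
  A cylinder, the set of points with prescribed initial partial quotients, is an interval whose
  length is multiplicative under concatenation of words up to a factor 2. Hence, under Lebesgue
  measure, blocks of partial quotients are independent up to constants. The denominators of
  \<open>[\<lambda>, \<dots>, \<lambda>]\<close> grow like powers of \<open>\<tau>(\<lambda>)\<close>, so a block of length \<open>k\<close> consists only of \<open>\<lambda>\<close>s with
  probability comparable to \<open>\<tau>(\<lambda>)^(-2k)\<close>.
  For the upper bounds, a union bound over the starting position (and over \<open>\<lambda>\<close>, where \<open>\<lambda> = 1\<close>
  dominates) gives failure probability \<open>O((log n)^(-2c))\<close>. For the lower bound, cut the first \<open>n\<close>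
  partial quotients into disjoint blocks: all of them fail with probability at most
  \<open>exp(-C (log n)^(2c - 1))\<close>. Both are summable along \<open>n = 2^m\<close> because \<open>c > 1/2\<close>;
  Borel--Cantelli and monotonicity in \<open>n\<close> conclude.
\<close>

section \<open>Lengths of cylinders\<close>

abbreviation irr :: "real set" where "irr \<equiv> {0..<1} - \<rat>"

text \<open>The inverse branches of the iterates of \<open>gauss_map\<close>: \<open>t\<close> plays
  the role of the tail that follows the partial quotients \<open>w\<close>.\<close>

fun branch :: "nat list \<Rightarrow> real \<Rightarrow> real" where
  "branch [] t = t"
| "branch (a # w) t = 1 / (real a + branch w t)"

text \<open>The pair of the last two continuant denominators \<open>(q n, q (n - 1))\<close>.\<close>

definition dens :: "nat list \<Rightarrow> real \<times> real" where
  "dens w = foldl (\<lambda>(q, r) a. (real a * q + r, q)) (1, 0) w"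

lemma dens_Nil [simp]: "dens [] = (1, 0)"
  by (simp add: dens_def)

lemma dens_snoc [simp]: "dens (w @ [a]) = (real a * fst (dens w) + snd (dens w), fst (dens w))"
  by (simp add: dens_def case_prod_beta)

lemma dens_bounds:
  assumes "\<forall>a\<in>set w. 1 \<le> a"
  shows "1 \<le> fst (dens w) \<and> 0 \<le> snd (dens w) \<and> snd (dens w) \<le> fst (dens w)"
  using assms
proof (induction w rule: rev_induct)
  case (snoc a w)
  then have IH: "1 \<le> fst (dens w)" "0 \<le> snd (dens w)" "snd (dens w) \<le> fst (dens w)"
    and a: "1 \<le> real a"
    by auto
  from mult_right_mono[OF a, of "fst (dens w)"] IH
  have "fst (dens w) \<le> real a * fst (dens w)" by simp
  with IH show ?case unfolding dens_snoc fst_conv snd_conv by linarith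
qed simp

lemma branch_append: "branch (u @ v) t = branch u (branch v t)"
  by (induction u) simp_all

lemma branch_range:
  assumes "\<forall>a\<in>set w. 1 \<le> a" "0 \<le> t" "t \<le> 1"
  shows "0 \<le> branch w t \<and> branch w t \<le> 1"
  using assms by (induction w) (auto simp: field_simps)

text \<open>\<open>branch w\<close> is a Moebius map of determinant 1 or -1 whose denominator at
  \<open>t\<close> is q + t r, with (q, r) = \<open>dens w\<close>. Peeling off the last letter
  keeps the numerators out of the induction: only the continuant recurrence enters.\<close>

lemma branch_diff:
  assumes "\<forall>a\<in>set w. 1 \<le> a" "0 \<le> s" "0 \<le> t"
  shows "\<bar>branch w s - branch w t\<bar> =
    \<bar>s - t\<bar> / ((fst (dens w) + s * snd (dens w)) * (fst (dens w) + t * snd (dens w)))"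
  using assms
proof (induction w arbitrary: s t rule: rev_induct)
  case (snoc a w)
  let ?q = "fst (dens w)" and ?r = "snd (dens w)"
  have a: "1 \<le> real a" using snoc.prems by simp
  \<comment> \<open>Clearing the inner denominator turns q + r / (a + y) into (a q + r) + y q, which
    is built from the two entries of \<open>dens (w @ [a])\<close>.\<close>
  have eq: "?q * (real a + y) + ?r = (?q + 1 / (real a + y) * ?r) * (real a + y)" if "0 \<le> y" for y
    using a that by (simp add: field_simps)
  have "\<bar>branch (w @ [a]) s - branch (w @ [a]) t\<bar>
      = \<bar>branch w (1 / (real a + s)) - branch w (1 / (real a + t))\<bar>"
    by (simp add: branch_append)
  also have "\<dots> = \<bar>1 / (real a + s) - 1 / (real a + t)\<bar> /
      ((?q + 1 / (real a + s) * ?r) * (?q + 1 / (real a + t) * ?r))"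
    by (rule snoc.IH) (use snoc.prems a in auto)
  also have "\<dots> = \<bar>s - t\<bar> / (((?q + 1 / (real a + s) * ?r) * (real a + s)) *
      ((?q + 1 / (real a + t) * ?r) * (real a + t)))"
    by (subst inverse_shift_diff) (use a snoc.prems in \<open>simp_all add: mult_ac\<close>)
  also have "\<dots> = \<bar>s - t\<bar> / ((?q * (real a + s) + ?r) * (?q * (real a + t) + ?r))"
    using eq[of s] eq[of t] snoc.prems by simp
  finally show ?case by (simp add: algebra_simps)
qed simp

text \<open>Each letter contributes a decreasing map, so the orientation of \<open>branch w\<close>
  alternates with the length of \<open>w\<close>; hence the absolute value.\<close>

definition cyl_len :: "nat list \<Rightarrow> real" where
  "cyl_len w = \<bar>branch w 0 - branch w 1\<bar>"

lemma cyl_len_eq: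
  assumes "\<forall>a\<in>set w. 1 \<le> a"
  shows "cyl_len w = 1 / (fst (dens w) * (fst (dens w) + snd (dens w)))"
  unfolding cyl_len_def by (subst branch_diff[OF assms]) simp_all

text \<open>By \<open>branch_diff\<close>, prepending \<open>u\<close> divides the length by (q + s
  r)(q + t r), where (q, r) = \<open>dens u\<close> and s, t in [0,1] are the values of
  \<open>branch v\<close> at 0 and 1. As 0 <= r <= q, this is within a factor 2 of q (q + r), the
  reciprocal of \<open>cyl_len u\<close>.\<close>

lemma cyl_len_append:
  assumes "\<forall>a\<in>set u. 1 \<le> a" "\<forall>a\<in>set v. 1 \<le> a"
  shows "cyl_len (u @ v) \<le> 2 * cyl_len v * cyl_len u" (is ?upper)
    and "1 / 2 * cyl_len v * cyl_len u \<le> cyl_len (u @ v)" (is ?lower)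
proof -
  obtain q r where qr: "dens u = (q, r)" by force
  have b: "1 \<le> q" "0 \<le> r" "r \<le> q" using dens_bounds[OF assms(1)] qr by auto
  define s t where "s = branch v 0" and "t = branch v 1"
  have st: "0 \<le> s" "s \<le> 1" "0 \<le> t" "t \<le> 1"
    using branch_range[OF assms(2)] by (auto simp: s_def t_def)
  have uv: "cyl_len (u @ v) = cyl_len v / ((q + s * r) * (q + t * r))"
    unfolding cyl_len_def branch_append s_def[symmetric] t_def[symmetric]
    by (subst branch_diff[OF assms(1)]) (use st qr in auto)
  have u: "cyl_len u = 1 / (q * (q + r))"
    using cyl_len_eq[OF assms(1)] qr by simp
  have sr: "0 \<le> s * r" "s * r \<le> r" "0 \<le> t * r" "t * r \<le> r"
    using st b by (auto intro: mult_left_le_one_le)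
  have v: "0 \<le> cyl_len v" by (simp add: cyl_len_def)
  have pos: "0 < q * (q + r)" "0 < (q + s * r) * (q + t * r)"
    using b sr by (auto intro!: mult_pos_pos add_pos_nonneg)
  have "q * (q + r) \<le> q * (2 * q)" using b by (intro mult_left_mono) auto
  also have "\<dots> \<le> 2 * ((q + s * r) * (q + t * r))"
    using mult_mono[of q "q + s * r" q "q + t * r"] b sr by simp
  finally have 1: "1 / ((q + s * r) * (q + t * r)) \<le> 2 / (q * (q + r))"
    using pos by (simp add: field_simps)
  have "(q + s * r) * (q + t * r) \<le> (q + r) * (q + r)"
    using b sr by (intro mult_mono) auto
  also have "\<dots> \<le> 2 * q * (q + r)"
    using b by (intro mult_right_mono) auto
  finally have 2: "1 / 2 / (q * (q + r)) \<le> 1 / ((q + s * r) * (q + t * r))"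
    using pos by (simp add: field_simps)
  show ?upper using mult_left_mono[OF 1 v] by (simp add: uv u mult_ac)
  show ?lower using mult_left_mono[OF 2 v] by (simp add: uv u mult_ac)
qed

section \<open>The numbers \<open>tau l\<close> and cylinders of constant words\<close>

lemma tau_props:
  shows "(tau l)\<^sup>2 = real l * tau l + 1" "1 \<le> l \<Longrightarrow> 1 < tau l" "real l \<le> tau l"
    "l \<le> m \<Longrightarrow> tau l \<le> tau m"
proof -
  have "(sqrt ((real l)\<^sup>2 + 4))\<^sup>2 = (real l)\<^sup>2 + 4" by simp
  then show "(tau l)\<^sup>2 = real l * tau l + 1"
    unfolding tau_def by (simp add: power2_eq_square field_simps)
  have s: "real l \<le> sqrt ((real l)\<^sup>2 + 4)" by (rule real_le_rsqrt) simp
  then show "real l \<le> tau l" by (simp add: tau_def)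
  have "0 < 3 + (real l)\<^sup>2" by (rule add_pos_nonneg) auto
  then have "1 < sqrt ((real l)\<^sup>2 + 4)" by simp
  moreover have "1 \<le> l \<Longrightarrow> 1 \<le> real l" by simp
  ultimately show "1 \<le> l \<Longrightarrow> 1 < tau l" by (simp add: tau_def del: real_sqrt_lt_1_iff real_sqrt_gt_1_iff)
  show "l \<le> m \<Longrightarrow> tau l \<le> tau m"
    unfolding tau_def by (intro divide_right_mono add_mono real_sqrt_le_mono power_mono) auto
qed

text \<open>The powers of \<open>tau l\<close> obey the continuant recurrence of the constant word;
  the extra factor \<open>tau l\<close> avoids the exponent k - 1.\<close>

lemma tau_rec: "real l * tau l * tau l ^ k + tau l ^ k = tau l * tau l ^ Suc k"
proof -
  have "real l * tau l * tau l ^ k + tau l ^ k = (real l * tau l + 1) * tau l ^ k"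
    by (simp add: distrib_right)
  also have "\<dots> = tau l * tau l ^ Suc k"
    by (simp flip: tau_props(1) add: power2_eq_square)
  finally show ?thesis .
qed

text \<open>Both entries are compared with consecutive powers of \<open>tau l\<close> at once,
  because the recurrence couples them.\<close>

lemma dens_replicate_le:
  "fst (dens (replicate k l)) \<le> tau l ^ k \<and> tau l * snd (dens (replicate k l)) \<le> tau l ^ k"
proof (induction k)
  case (Suc k)
  let ?d = "dens (replicate k l)"
  have t: "0 < tau l"
    unfolding tau_def by (simp add: add_nonneg_pos)
  have "tau l * (real l * fst ?d + snd ?d) = real l * tau l * fst ?d + tau l * snd ?d"
    by (simp add: algebra_simps)
  also have "\<dots> \<le> real l * tau l * tau l ^ k + tau l ^ k"
    using Suc t by (intro add_mono mult_left_mono) auto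
  also have "\<dots> = tau l * tau l ^ Suc k"
    by (rule tau_rec)
  finally have "real l * fst ?d + snd ?d \<le> tau l ^ Suc k" using t by simp
  moreover have "tau l * fst ?d \<le> tau l ^ Suc k" using Suc t by simp
  \<comment> \<open>A constant word grows equally well at its end, where the recurrence of
    \<open>dens\<close> applies.\<close>
  moreover have "dens (replicate (Suc k) l) = (real l * fst ?d + snd ?d, fst ?d)"
    by (subst replicate_Suc, subst replicate_append_same[symmetric]) (rule dens_snoc)
  ultimately show ?case by simp
qed (simp add: tau_def add_nonneg_nonneg)

text \<open>The empty word has second entry 0, so the comparison starts at length one and loses one
  factor \<open>tau l\<close>.\<close>

lemma dens_replicate_ge:
  assumes "1 \<le> l"
  shows "tau l ^ k \<le> fst (dens (replicate (Suc k) l)) \<and>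
    tau l ^ k \<le> tau l * snd (dens (replicate (Suc k) l))"
proof (induction k)
  case 0
  show ?case using assms tau_props(2)[OF assms] by (simp add: dens_def)
next
  case (Suc k)
  let ?d = "dens (replicate (Suc k) l)"
  have t: "1 < tau l" using tau_props(2)[OF assms] .
  have "tau l * tau l ^ Suc k = real l * tau l * tau l ^ k + tau l ^ k"
    by (rule tau_rec[symmetric])
  also have "\<dots> \<le> real l * tau l * fst ?d + tau l * snd ?d"
    using Suc t by (intro add_mono mult_left_mono) auto
  also have "\<dots> = tau l * (real l * fst ?d + snd ?d)"
    by (simp add: algebra_simps)
  finally have "tau l ^ Suc k \<le> real l * fst ?d + snd ?d" using t by simp
  moreover have "tau l ^ Suc k \<le> tau l * fst ?d" using Suc t by simp
  moreover have "dens (replicate (Suc (Suc k)) l) = (real l * fst ?d + snd ?d, fst ?d)"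
    by (subst replicate_Suc, subst replicate_append_same[symmetric]) (rule dens_snoc)
  ultimately show ?case by simp
qed

text \<open>The length is 1 / (q (q + r)). The lower bound uses r <= q and q <=
  \<open>tau l ^ k\<close>; the upper bound uses \<open>tau l ^ k\<close> <= \<open>tau l\<close> q,
  whose lost factor reappears squared.\<close>

lemma cyl_len_replicate:
  assumes "1 \<le> l"
  shows "1 / (2 * tau l ^ (2 * k)) \<le> cyl_len (replicate k l)" (is ?lower)
    and "cyl_len (replicate k l) \<le> tau l ^ 2 / tau l ^ (2 * k)" (is ?upper)
proof -
  let ?w = "replicate k l"
  obtain q r where qr: "dens ?w = (q, r)" by force
  have w: "\<forall>a\<in>set ?w. 1 \<le> a" using assms by auto
  have b: "1 \<le> q" "0 \<le> r" "r \<le> q" using dens_bounds[OF w] qr by auto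
  have t: "1 < tau l" using tau_props(2)[OF assms] .
  have len: "cyl_len ?w = 1 / (q * (q + r))" using cyl_len_eq[OF w] qr by simp
  have q_le: "q \<le> tau l ^ k" using dens_replicate_le[of k l] qr by simp
  have "q * (q + r) \<le> tau l ^ k * (2 * tau l ^ k)"
    using b q_le by (intro mult_mono) auto
  also have "\<dots> = 2 * tau l ^ (2 * k)" by (simp add: power_even_eq power2_eq_square)
  finally show ?lower using b t by (simp add: len frac_le)
  have "tau l ^ k \<le> tau l * q"
  proof (cases k)
    case 0
    then show ?thesis using mult_mono[of 1 "tau l" 1 q] b t by simp
  next
    case (Suc j)
    then show ?thesis using dens_replicate_ge[OF assms, of j] qr t by simp
  qed
  then have "tau l ^ k * tau l ^ k \<le> (tau l * q) * (tau l * q)"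
    using t b by (intro mult_mono) auto
  also have "\<dots> = (tau l)\<^sup>2 * (q * q)" by (simp add: power2_eq_square)
  also have "\<dots> \<le> (tau l)\<^sup>2 * (q * (q + r))"
    using b by (intro mult_left_mono) auto
  finally have "tau l ^ (2 * k) \<le> (tau l)\<^sup>2 * (q * (q + r))"
    by (simp add: power_even_eq power2_eq_square)
  moreover have "0 < q * (q + r)" using b by simp
  ultimately show ?upper using t by (simp add: len field_simps)
qed

section \<open>Quasi-independence of the partial quotients\<close>

definition digits :: "nat \<Rightarrow> nat \<Rightarrow> real \<Rightarrow> nat list" where
  "digits j k x = map (\<lambda>i. cf_digit (Suc (j + i)) x) [0..<k]"

lemma length_digits [simp]: "length (digits j k x) = k"
  by (simp add: digits_def)

lemma digits_0_Suc: "digits 0 (Suc k) x = cf_digit 1 x # digits 0 k (gauss_map x)"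
proof -
  have "[0..<Suc k] = 0 # map Suc [0..<k]"
    by (simp add: upt_conv_Cons map_Suc_upt del: upt_Suc)
  then show ?thesis by (simp add: digits_def cf_digit_Suc o_def del: upt_Suc)
qed

lemma digits_add: "digits j (k + m) x = digits j k x @ digits (j + k) m x"
proof -
  have "map (\<lambda>i. f (j + i)) [0..<k + m] = map (\<lambda>i. f (j + i)) [0..<k] @ map (\<lambda>i. f (j + k + i)) [0..<m]"
    for f :: "nat \<Rightarrow> nat"
    by (induction m) (simp_all add: add.assoc)
  from this[of "\<lambda>i. cf_digit (Suc i) x"] show ?thesis by (simp add: digits_def)
qed

lemma digits_pos: "x \<in> irr \<Longrightarrow> \<forall>a\<in>set (digits j k x). 1 \<le> a"
  using cf_digit_pos[of x] by (auto simp: digits_def)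

lemma digits_eq_replicate_iff:
  "digits j k x = replicate k l \<longleftrightarrow> (\<forall>i\<in>{1..k}. cf_digit (j + i) x = l)"
proof -
  have "digits j k x = replicate k l \<longleftrightarrow> (\<forall>i<k. cf_digit (j + Suc i) x = l)"
    by (auto simp: list_eq_iff_nth_eq digits_def)
  also have "\<dots> \<longleftrightarrow> (\<forall>i\<in>{1..k}. cf_digit (j + i) x = l)"
    unfolding Ball_def by (metis Suc_le_eq Suc_le_D atLeastAtMost_iff One_nat_def le_add1 plus_1_eq_Suc)
  finally show ?thesis .
qed

section \<open>Cylinders as intervals\<close>

definition cyl :: "nat list \<Rightarrow> real set" where
  "cyl w = {x \<in> irr. digits 0 (length w) x = w}"

lemma cyl_Cons: "cyl (a # w) = {x \<in> irr. cf_digit 1 x = a \<and> gauss_map x \<in> cyl w}"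
  using gauss_map_irrational by (auto simp: cyl_def digits_0_Suc)

text \<open>The map y -> 1 / (a + y) is decreasing, so the end points swap. Since the interval lies
  in [0,1], 1 / x lies strictly between a and a + 1, which determines the first partial
  quotient.\<close>

lemma branch_step_interval:
  assumes x: "x \<in> irr" and "1 \<le> a" "0 \<le> s" "s \<le> t" "t \<le> 1"
  shows "cf_digit 1 x = a \<and> gauss_map x \<in> {s<..<t} \<longleftrightarrow>
    x \<in> {1 / (real a + t)<..<1 / (real a + s)}"
proof
  assume "cf_digit 1 x = a \<and> gauss_map x \<in> {s<..<t}"
  moreover have "x = 1 / (real (cf_digit 1 x) + gauss_map x)" by (rule cf_digit_step(2)[OF x])
  ultimately have "x = 1 / (real a + gauss_map x)" "s < gauss_map x" "gauss_map x < t" by auto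
  moreover have "1 / (real a + t) < 1 / (real a + gauss_map x)"
      "1 / (real a + gauss_map x) < 1 / (real a + s)"
    using assms calculation(2,3) by (auto intro!: divide_strict_left_mono mult_pos_pos)
  ultimately show "x \<in> {1 / (real a + t)<..<1 / (real a + s)}" by simp
next
  assume *: "x \<in> {1 / (real a + t)<..<1 / (real a + s)}"
  have "x \<noteq> 0" using x by auto
  then have x0: "0 < x" using x by auto
  have pos: "0 < real a + s" "0 < real a + t" using assms by auto
  from * have y: "real a + s < 1 / x" "1 / x < real a + t"
    using x0 pos by (auto simp: field_simps)
  then have "\<lfloor>1 / x\<rfloor> = int a" using assms by (intro floor_unique) auto
  then show "cf_digit 1 x = a \<and> gauss_map x \<in> {s<..<t}"
    using y by (simp add: cf_digit_def gauss_map_def frac_def algebra_simps)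
qed

text \<open>Induction by \<open>branch_step_interval\<close>; \<open>min\<close> and
  \<open>max\<close> absorb the changes of orientation. The interval can be open because its end
  points are rational.\<close>

lemma cyl_eq:
  assumes "\<forall>a\<in>set w. 1 \<le> a"
  shows "cyl w = irr \<inter> {min (branch w 0) (branch w 1)<..<max (branch w 0) (branch w 1)}"
  using assms
proof (induction w)
  case Nil
  \<comment> \<open>The empty word compares [0,1) with (0,1), so the point 0 must be
    excluded.\<close>
  have "x \<noteq> 0" if "x \<in> irr" for x using that by auto
  then show ?case by (fastforce simp: cyl_def digits_def)
next
  case (Cons a w)
  define s where "s = min (branch w 0) (branch w 1)"
  define t where "t = max (branch w 0) (branch w 1)"
  have b: "0 \<le> s" "s \<le> t" "t \<le> 1"
    using branch_range[of w 0] branch_range[of w 1] Cons.prems by (auto simp: s_def t_def)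
  have st: "min (branch (a # w) 0) (branch (a # w) 1) = 1 / (real a + t)"
      "max (branch (a # w) 0) (branch (a # w) 1) = 1 / (real a + s)"
  proof -
    have anti: "1 / (real a + v) \<le> 1 / (real a + u)" if "0 \<le> u" "u \<le> v" for u v
      using that Cons.prems by (intro divide_left_mono) auto
    have r: "0 \<le> branch w 0" "0 \<le> branch w 1"
      using branch_range[of w 0] branch_range[of w 1] Cons.prems by auto
    show "min (branch (a # w) 0) (branch (a # w) 1) = 1 / (real a + t)"
      "max (branch (a # w) 0) (branch (a # w) 1) = 1 / (real a + s)"
      using anti[of "branch w 0" "branch w 1"] anti[of "branch w 1" "branch w 0"] r
      by (cases "branch w 0 \<le> branch w 1"; simp add: s_def t_def min_def max_def; fail)+
  qed
  have "cyl (a # w) = {x \<in> irr. cf_digit 1 x = a \<and> gauss_map x \<in> {s<..<t}}"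
    unfolding cyl_Cons using Cons gauss_map_irrational by (auto simp: s_def t_def)
  also have "\<dots> = {x \<in> irr. x \<in> {1 / (real a + t)<..<1 / (real a + s)}}"
    using branch_step_interval[of _ a s t] b Cons.prems by auto
  finally show ?case unfolding st by blast
qed

lemma emeasure_cyl:
  assumes "\<forall>a\<in>set w. 1 \<le> a"
  shows "cyl w \<in> sets lborel" "emeasure lborel (cyl w) = ennreal (cyl_len w)"
proof -
  define s where "s = min (branch w 0) (branch w 1)"
  define t where "t = max (branch w 0) (branch w 1)"
  have b: "0 \<le> s" "s \<le> t" "t \<le> 1"
    using branch_range[of w 0] branch_range[of w 1] assms by (auto simp: s_def t_def)
  have len: "cyl_len w = t - s"
    unfolding cyl_len_def s_def t_def by linarith
  have "cyl w = irr \<inter> {s<..<t}"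
    unfolding s_def t_def by (rule cyl_eq[OF assms])
  then have eq: "cyl w = {s<..<t} - \<rat>"
    using b by fastforce
  have null: "\<rat> \<in> null_sets (lborel :: real measure)"
    by (rule countable_imp_null_set_lborel[OF countable_rat])
  then show "cyl w \<in> sets lborel" unfolding eq by (intro sets.Diff) auto
  show "emeasure lborel (cyl w) = ennreal (cyl_len w)"
    unfolding eq by (subst emeasure_Diff_null_set[OF null]) (use b len in auto)
qed

section \<open>Measurability of the digits and bounded distortion\<close>

lemma measurable_gauss_map [measurable]: "gauss_map \<in> borel_measurable borel"
  unfolding gauss_map_def[abs_def] frac_def by measurable

lemma measurable_cf_digit [measurable]: "cf_digit n \<in> measurable borel (count_space UNIV)"
proof -
  have [measurable]: "gauss_map ^^ m \<in> borel_measurable borel" for m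
    by (rule measurable_compose_n) measurable
  show ?thesis unfolding cf_digit_def[abs_def] by measurable
qed

text \<open>Quasi-independence of a block from its past, where \<open>D\<close> is any condition on
  the first \<open>j\<close> partial quotients. Both events are countable disjoint unions of
  cylinders, with words \<open>u\<close> and \<open>u @ v\<close>; \<open>cyl_len_append\<close>
  compares them term by term.\<close>

lemma emeasure_digits_distortion:
  assumes "\<forall>a\<in>set v. 1 \<le> a"
  shows "emeasure lborel {x \<in> irr. digits 0 j x \<in> D \<and> digits j (length v) x = v}
      \<le> ennreal (2 * cyl_len v) * emeasure lborel {x \<in> irr. digits 0 j x \<in> D}" (is "emeasure _ ?B \<le> _ * emeasure _ ?A")
    and "ennreal (1 / 2 * cyl_len v) * emeasure lborel {x \<in> irr. digits 0 j x \<in> D}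
      \<le> emeasure lborel {x \<in> irr. digits 0 j x \<in> D \<and> digits j (length v) x = v}"
proof -
  \<comment> \<open>Only words of length \<open>j\<close> with positive letters occur as initial
    blocks of points of \<open>irr\<close>.\<close>
  define I where "I = {u \<in> D. length u = j \<and> (\<forall>a\<in>set u. 1 \<le> a)}"
  have I: "\<forall>a\<in>set u. 1 \<le> a" "length u = j" if "u \<in> I" for u using that by (auto simp: I_def)
  have Iv: "\<forall>a\<in>set (u @ v). 1 \<le> a" if "u \<in> I" for u using I[OF that] assms by auto
  \<comment> \<open>The suffix \<open>w\<close> is general: the empty word yields the event on the
    past, \<open>v\<close> the joint event.\<close>
  have union: "emeasure lborel (\<Union>u\<in>I. cyl (u @ w)) = (\<integral>\<^sup>+u. ennreal (cyl_len (u @ w)) \<partial>count_space I)"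
    if w: "\<forall>a\<in>set w. 1 \<le> a" for w
  proof -
    have uw: "\<forall>a\<in>set (u @ w). 1 \<le> a" if "u \<in> I" for u using I[OF that] w by auto
    have "emeasure lborel (\<Union>u\<in>I. cyl (u @ w)) = (\<integral>\<^sup>+u. emeasure lborel (cyl (u @ w)) \<partial>count_space I)"
    proof (rule emeasure_UN_countable)
      show "disjoint_family_on (\<lambda>u. cyl (u @ w)) I"
        using I(2) by (auto simp: disjoint_family_on_def cyl_def)
    qed (use emeasure_cyl(1) uw in auto)
    also have "\<dots> = (\<integral>\<^sup>+u. ennreal (cyl_len (u @ w)) \<partial>count_space I)"
      by (intro nn_integral_cong) (use emeasure_cyl(2) uw in auto)
    finally show ?thesis .
  qed
  have A: "?A = (\<Union>u\<in>I. cyl (u @ []))"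
    using digits_pos by (auto simp: I_def cyl_def)
  have B: "?B = (\<Union>u\<in>I. cyl (u @ v))"
    using digits_pos by (auto simp: I_def cyl_def digits_add)
  have v0: "0 \<le> cyl_len v" by (simp add: cyl_len_def)
  have len0: "0 \<le> cyl_len u" for u by (simp add: cyl_len_def)
  have "emeasure lborel ?B \<le> (\<integral>\<^sup>+u. ennreal (2 * cyl_len v) * ennreal (cyl_len (u @ [])) \<partial>count_space I)"
    unfolding B union[OF assms]
    by (intro nn_integral_mono)
      (use cyl_len_append(1)[OF I(1) assms] v0 len0 in \<open>simp add: ennreal_mult[symmetric] ennreal_leI\<close>)
  also have "\<dots> = ennreal (2 * cyl_len v) * emeasure lborel ?A"
    unfolding A by (subst union) (simp_all add: nn_integral_cmult)
  finally show "emeasure lborel ?B \<le> ennreal (2 * cyl_len v) * emeasure lborel ?A" .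
  have "ennreal (1 / 2 * cyl_len v) * emeasure lborel ?A =
      (\<integral>\<^sup>+u. ennreal (1 / 2 * cyl_len v) * ennreal (cyl_len (u @ [])) \<partial>count_space I)"
    unfolding A by (subst union) (simp_all add: nn_integral_cmult)
  also have "\<dots> \<le> emeasure lborel ?B"
    unfolding B union[OF assms]
    by (intro nn_integral_mono)
      (use cyl_len_append(2)[OF I(1) assms] v0 len0 in \<open>simp add: ennreal_mult[symmetric] ennreal_leI\<close>)
  finally show "ennreal (1 / 2 * cyl_len v) * emeasure lborel ?A \<le> emeasure lborel ?B" .
qed

lemma emeasure_irr: "emeasure lborel irr = 1"
proof -
  have "emeasure lborel (cyl []) = ennreal (cyl_len [])" by (rule emeasure_cyl) simp
  moreover have "cyl [] = irr" by (simp add: cyl_def digits_def set_diff_eq)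
  ultimately show ?thesis by (simp add: cyl_len_def)
qed

section \<open>Distribution of the longest runs\<close>

lemma emeasure_run_le:
  assumes "1 \<le> l"
  shows "emeasure lborel {x \<in> irr. digits j k x = replicate k l}
    \<le> ennreal (2 * (tau l ^ 2 / tau l ^ (2 * k)))"
proof -
  have "emeasure lborel {x \<in> irr. digits j k x = replicate k l}
      \<le> ennreal (2 * cyl_len (replicate k l))"
    using emeasure_digits_distortion(1)[of "replicate k l" j UNIV] assms emeasure_irr
    by (simp add: set_diff_eq)
  also have "\<dots> \<le> ennreal (2 * (tau l ^ 2 / tau l ^ (2 * k)))"
    using cyl_len_replicate(2)[OF assms, of k] by (intro ennreal_leI) simp
  finally show ?thesis .
qed

text \<open>The inner sum counts the lengths m for which the m entries after position
  \<open>j\<close> all equal \<open>l\<close>. These lengths form an initial segment, so there are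
  at least \<open>k\<close> of them exactly when \<open>k\<close> itself is one.\<close>

lemma le_run_length_iff:
  assumes "1 \<le> k"
  shows "k \<le> run_length n x l \<longleftrightarrow> (\<exists>j. j + k \<le> n \<and> digits j k x = replicate k l)"
proof -
  define S where "S j = (\<Sum>k=1..n - j. \<Prod>i=1..k. of_bool (cf_digit (j + i) x = l) :: nat)" for j
  have prefix: "(\<Prod>i=1..m. of_bool (cf_digit (j + i) x = l) :: nat)
      = of_bool (\<forall>i\<in>{1..m}. cf_digit (j + i) x = l)" for j m
    by (auto simp: of_bool_def prod_zero_iff)
  have S: "S j = card {m \<in> {1..n - j}. \<forall>i\<in>{1..m}. cf_digit (j + i) x = l}" for j
    unfolding S_def prefix by (simp add: of_bool_def sum.If_cases Int_def)
  have key: "k \<le> S j \<longleftrightarrow> k \<le> n - j \<and> (\<forall>i\<in>{1..k}. cf_digit (j + i) x = l)" for j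
  proof
    assume k: "k \<le> S j"
    have "k \<le> n - j"
    proof -
      have "S j \<le> card {1..n - j}" unfolding S by (intro card_mono) auto
      with k show ?thesis by simp
    qed
    moreover have "\<forall>i\<in>{1..k}. cf_digit (j + i) x = l"
    proof (rule ccontr)
      assume "\<not> (\<forall>i\<in>{1..k}. cf_digit (j + i) x = l)"
      then obtain i where i: "1 \<le> i" "i \<le> k" "cf_digit (j + i) x \<noteq> l" by auto
      have "m < i" if "\<forall>i\<in>{1..m}. cf_digit (j + i) x = l" for m
      proof (rule ccontr)
        assume "\<not> m < i"
        with that i show False by auto
      qed
      then have "{m \<in> {1..n - j}. \<forall>i\<in>{1..m}. cf_digit (j + i) x = l} \<subseteq> {1..<i}"
        by auto
      then have "S j \<le> card {1..<i}" unfolding S by (intro card_mono) auto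
      with k i show False by simp
    qed
    ultimately show "k \<le> n - j \<and> (\<forall>i\<in>{1..k}. cf_digit (j + i) x = l)" by simp
  next
    assume *: "k \<le> n - j \<and> (\<forall>i\<in>{1..k}. cf_digit (j + i) x = l)"
    then have "{1..k} \<subseteq> {m \<in> {1..n - j}. \<forall>i\<in>{1..m}. cf_digit (j + i) x = l}" by auto
    then have "card {1..k} \<le> S j" unfolding S by (intro card_mono) auto
    then show "k \<le> S j" by simp
  qed
  have "k \<le> run_length n x l \<longleftrightarrow> (\<exists>j\<in>{0..n - 1}. k \<le> S j)"
    unfolding run_length_def S_def[symmetric] by (subst Max_ge_iff) auto
  also have "\<dots> \<longleftrightarrow> (\<exists>j. j + k \<le> n \<and> (\<forall>i\<in>{1..k}. cf_digit (j + i) x = l))"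
    unfolding key
  proof safe
    fix j assume "k \<le> n - j" "\<forall>i\<in>{1..k}. cf_digit (j + i) x = l"
    \<comment> \<open>As \<open>k\<close> is positive, \<open>k \<le> n - j\<close> forces the
      truncated difference to be positive, so it does mean \<open>j + k \<le> n\<close>.\<close>
    with assms show "\<exists>j. j + k \<le> n \<and> (\<forall>i\<in>{1..k}. cf_digit (j + i) x = l)"
      by (intro exI[of _ j]) auto
  next
    fix j assume "j + k \<le> n" "\<forall>i\<in>{1..k}. cf_digit (j + i) x = l"
    with assms show "\<exists>j\<in>{0..n - 1}. k \<le> n - j \<and> (\<forall>i\<in>{1..k}. cf_digit (j + i) x = l)"
      by (intro bexI[of _ j]) auto
  qed
  finally show ?thesis by (simp add: digits_eq_replicate_iff)
qed

lemma le_max_run_length_iff: "k \<le> max_run_length n x \<longleftrightarrow> (\<exists>l\<ge>1. k \<le> run_length n x l)"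
  unfolding max_run_length_def by (subst Max_ge_iff[OF finite_run_lengths]) auto

lemma run_length_mono:
  assumes "m \<le> n"
  shows "run_length m x l \<le> run_length n x l"
proof (cases "run_length m x l = 0")
  case False
  then have "\<exists>j. j + run_length m x l \<le> m \<and>
      digits j (run_length m x l) x = replicate (run_length m x l) l"
    by (subst le_run_length_iff[symmetric]) auto
  with False assms show ?thesis by (subst le_run_length_iff) (auto intro: order_trans)
qed simp

lemma run_length_le_max_run_length: "1 \<le> l \<Longrightarrow> run_length n x l \<le> max_run_length n x"
  using le_max_run_length_iff by blast

lemma max_run_length_mono:
  assumes "m \<le> n"
  shows "max_run_length m x \<le> max_run_length n x"
proof -
  obtain l where "1 \<le> l" "max_run_length m x \<le> run_length m x l"
    using le_max_run_length_iff[of "max_run_length m x" m x] by auto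
  with run_length_mono[OF assms, of x l] show ?thesis
    using run_length_le_max_run_length[of l n x] by linarith
qed

section \<open>Measurability of the run events\<close>

lemma sets_digits_eq [measurable]: "{x \<in> irr. digits j k x = replicate k l} \<in> sets lborel"
proof -
  have "{x \<in> irr. digits j k x = replicate k l}
      = irr \<inter> {x \<in> space borel. \<forall>i\<in>{1..k}. cf_digit (j + i) x = l}"
    by (auto simp: digits_eq_replicate_iff)
  also have "\<dots> \<in> sets lborel" by measurable
  finally show ?thesis .
qed

lemma run_length_event:
  assumes "1 \<le> k"
  shows "{x \<in> irr. k \<le> run_length n x l}
    = (\<Union>j\<in>{j. j + k \<le> n}. {x \<in> irr. digits j k x = replicate k l})"
  using le_run_length_iff[OF assms] by auto

lemma sets_run_length [measurable]: "{x \<in> irr. k \<le> run_length n x l} \<in> sets lborel"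
proof (cases "1 \<le> k")
  case True
  show ?thesis unfolding run_length_event[OF True]
    by (rule sets.countable_UN''[OF countableI_type sets_digits_eq])
next
  case False
  then have "{x \<in> irr. k \<le> run_length n x l} = irr" by auto
  then show ?thesis using irrational_unit_borel by (simp only: sets_lborel)
qed

lemma max_run_length_event:
  "{x \<in> irr. k \<le> max_run_length n x} = (\<Union>l\<in>{1..}. {x \<in> irr. k \<le> run_length n x l})"
  using le_max_run_length_iff by auto

lemma sets_max_run_length [measurable]: "{x \<in> irr. k \<le> max_run_length n x} \<in> sets lborel"
  unfolding max_run_length_event using sets_run_length
  by blast

section \<open>Probabilities of long runs and of missing runs\<close>

lemma emeasure_run_length_le:
  assumes "1 \<le> l" "1 \<le> k"
  shows "emeasure lborel {x \<in> irr. k \<le> run_length n x l}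
    \<le> ennreal (2 * real n * (tau l ^ 2 / tau l ^ (2 * k)))"
proof -
  let ?J = "{j. j + k \<le> n}"
  let ?e = "2 * (tau l ^ 2 / tau l ^ (2 * k))"
  \<comment> \<open>A run of positive length leaves at most \<open>n\<close> starting positions for
    the union bound.\<close>
  have J: "?J \<subseteq> {..<n}" using assms by auto
  then have fin: "finite ?J" by (rule finite_subset) simp
  have "emeasure lborel {x \<in> irr. k \<le> run_length n x l}
      \<le> (\<Sum>j\<in>?J. emeasure lborel {x \<in> irr. digits j k x = replicate k l})"
    unfolding run_length_event[OF assms(2)] using sets_digits_eq
    by (intro emeasure_subadditive_finite fin) blast
  also have "\<dots> \<le> (\<Sum>j\<in>?J. ennreal ?e)"
    by (intro sum_mono emeasure_run_le assms)
  also have "\<dots> \<le> (\<Sum>j<n. ennreal ?e)" by (intro sum_mono2 J) auto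
  also have "\<dots> = ennreal (real n * ?e)"
    using tau_props(2)[OF assms(1)] by (simp add: ennreal_of_nat_eq_real_of_nat ennreal_mult[symmetric])
  finally show ?thesis by (simp add: mult_ac)
qed

text \<open>For \<open>k \<ge> 2\<close> one factor \<open>\<tau>(l)^2\<close> can be traded for \<open>l^2\<close>, so that summing over \<open>l\<close>
  does not change the order of magnitude.\<close>

lemma tau_power_le:
  assumes "1 \<le> l" "2 \<le> k"
  shows "tau l ^ 2 / tau l ^ (2 * k) \<le> tau 1 ^ 4 / tau 1 ^ (2 * k) * (1 / real l ^ 2)"
proof -
  obtain m where m: "k = m + 2" using assms(2) by (metis le_add_diff_inverse2)
  have t: "1 < tau 1" "1 < tau l" "tau 1 \<le> tau l" "real l \<le> tau l"
    using tau_props assms by auto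
  have "tau l ^ 2 / tau l ^ (2 * k) = 1 / (tau l ^ (2 * m) * tau l ^ 2)"
    using t by (simp add: m power_add power2_eq_square field_simps)
  \<comment> \<open>\<open>tau l\<close> is bounded below by \<open>tau 1\<close> in the first
    factor and by \<open>l\<close> in the second.\<close>
  also have "\<dots> \<le> 1 / (tau 1 ^ (2 * m) * real l ^ 2)"
    using t assms by (intro divide_left_mono mult_mono power_mono mult_pos_pos) auto
  also have "\<dots> = tau 1 ^ 4 / tau 1 ^ (2 * k) * (1 / real l ^ 2)"
    using t assms by (simp add: m power_add power_numeral_reduce del: One_nat_def)
  finally show ?thesis .
qed

lemma emeasure_max_run_length_le:
  obtains C where "0 \<le> C"
    "\<And>n k. 2 \<le> k \<Longrightarrow> emeasure lborel {x \<in> irr. k \<le> max_run_length n x}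
      \<le> ennreal (C * real n / tau 1 ^ (2 * k))"
proof
  \<comment> \<open>Z = zeta(2) is what the union bound over all letters costs after
    \<open>tau_power_le\<close>.\<close>
  define Z where "Z = (\<Sum>l. 1 / real (Suc l) ^ 2)"
  have sm: "summable (\<lambda>l. 1 / real (Suc l) ^ 2)"
    using inverse_power_summable[of 2, where ?'a = real]
    by (subst summable_Suc_iff) (simp add: inverse_eq_divide)
  have Z: "0 \<le> Z" unfolding Z_def by (intro suminf_nonneg sm) auto
  have t: "1 < tau 1" using tau_props(2)[of 1] by simp
  show "0 \<le> 2 * tau 1 ^ 4 * Z" using Z t by simp
  fix n k :: nat assume k: "2 \<le> k"
  define B where "B = 2 * real n * (tau 1 ^ 4 / tau 1 ^ (2 * k))"
  have B: "0 \<le> B" using t by (simp add: B_def)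
  have "{1..} = range Suc"
    using atLeast_Suc_greaterThan[of 0] greaterThan_0 by simp
  then have "{x \<in> irr. k \<le> max_run_length n x} = (\<Union>l. {x \<in> irr. k \<le> run_length n x (Suc l)})"
    unfolding max_run_length_event by (simp only: image_image)
  also have "emeasure lborel \<dots> \<le> (\<Sum>l. emeasure lborel {x \<in> irr. k \<le> run_length n x (Suc l)})"
    using sets_run_length by (intro emeasure_subadditive_countably) auto
  also have "\<dots> \<le> (\<Sum>l. ennreal (B * (1 / real (Suc l) ^ 2)))"
  proof (rule suminf_le)
    fix l
    have "emeasure lborel {x \<in> irr. k \<le> run_length n x (Suc l)}
        \<le> ennreal (2 * real n * (tau (Suc l) ^ 2 / tau (Suc l) ^ (2 * k)))"
      by (rule emeasure_run_length_le) (use k in auto)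
    also have "\<dots> \<le> ennreal (2 * real n * (tau 1 ^ 4 / tau 1 ^ (2 * k) * (1 / real (Suc l) ^ 2)))"
      by (intro ennreal_leI mult_left_mono tau_power_le k) auto
    also have "\<dots> = ennreal (B * (1 / real (Suc l) ^ 2))" by (simp add: B_def)
    finally show "emeasure lborel {x \<in> irr. k \<le> run_length n x (Suc l)} \<le> \<dots>" .
  qed auto
  also have "\<dots> = ennreal (\<Sum>l. B * (1 / real (Suc l) ^ 2))"
    by (intro suminf_ennreal2 summable_mult sm) (use B in auto)
  also have "(\<Sum>l. B * (1 / real (Suc l) ^ 2)) = B * Z"
    unfolding Z_def by (rule suminf_mult[OF sm])
  finally show "emeasure lborel {x \<in> irr. k \<le> max_run_length n x}
      \<le> ennreal (2 * tau 1 ^ 4 * Z * real n / tau 1 ^ (2 * k))"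
    by (simp add: B_def mult_ac)
qed

text \<open>Without a run of length \<open>k\<close>, each of the \<open>b\<close> disjoint blocks
  of length \<open>k\<close> fails to be constant \<open>l\<close>. Whatever failures came before,
  the next block succeeds with conditional probability at least \<delta>, so all fail with
  probability at most (1 - \<delta>)^b <= exp(- \<delta> b).\<close>

lemma emeasure_no_run_le:
  assumes l: "1 \<le> l" and k: "1 \<le> k" and b: "b * k \<le> n"
  shows "emeasure lborel {x \<in> irr. run_length n x l < k}
    \<le> ennreal (exp (- (real b / (4 * tau l ^ (2 * k)))))"
proof -
  define F where "F b = {x \<in> irr. \<forall>i<b. digits (i * k) k x \<noteq> replicate k l}" for b
  define E where "E b = {x \<in> irr. digits (b * k) k x = replicate k l}" for b
  \<comment> \<open>One factor 1/2 comes from the distortion bound, the other from the lower bound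
    in \<open>cyl_len_replicate\<close>.\<close>
  define \<delta> where "\<delta> = 1 / (4 * tau l ^ (2 * k))"
  have E[measurable]: "E b \<in> sets lborel" for b unfolding E_def by measurable
  have F_Suc: "F (Suc b) = F b - E b" for b by (auto simp: F_def E_def less_Suc_eq)
  have F0: "F 0 = irr" by (auto simp: F_def)
  have F[measurable]: "F b \<in> sets lborel" for b
  proof (induction b)
    case 0
    show ?case using irrational_unit_borel by (simp only: F0 sets_lborel)
  next
    case (Suc b)
    then show ?case unfolding F_Suc using E by (rule sets.Diff)
  qed
  have fin: "emeasure lborel (F b) \<noteq> \<infinity>" for b
  proof -
    have "emeasure lborel (F b) \<le> emeasure lborel irr"
      by (rule emeasure_mono) (auto simp: F_def)
    then show ?thesis by (auto simp: emeasure_irr top_unique)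
  qed
  have step: "measure lborel (F (Suc b)) \<le> (1 - \<delta>) * measure lborel (F b)" for b
  proof -
    \<comment> \<open>The failure of the first \<open>b\<close> blocks, rewritten as a condition on
      the word of the first \<open>b * k\<close> digits, as the distortion lemma requires.\<close>
    define D where "D = {w. \<forall>i<b. take k (drop (i * k) w) \<noteq> replicate k l}"
    have block: "take k (drop (i * k) (digits 0 (b * k) x)) = digits (i * k) k x" if "i < b" for i x
    proof -
      have "i * k + k \<le> b * k" using that by (metis Suc_leI add.commute mult_Suc mult_le_mono1)
      then obtain m where m: "b * k = i * k + (k + m)" by (metis add.assoc le_Suc_ex)
      show ?thesis unfolding m digits_add by simp
    qed
    have FD: "F b = {x \<in> irr. digits 0 (b * k) x \<in> D}"
      unfolding F_def D_def using block by auto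
    have "F b \<inter> E b = {x \<in> irr. digits 0 (b * k) x \<in> D \<and>
        digits (b * k) (length (replicate k l)) x = replicate k l}"
      unfolding FD E_def by auto
    then have "ennreal (1 / 2 * cyl_len (replicate k l)) * emeasure lborel (F b)
        \<le> emeasure lborel (F b \<inter> E b)"
      unfolding FD using emeasure_digits_distortion(2)[of "replicate k l" "b * k" D] l by auto
    moreover have "ennreal \<delta> \<le> ennreal (1 / 2 * cyl_len (replicate k l))"
      using cyl_len_replicate(1)[OF l, of k] by (intro ennreal_leI) (simp add: \<delta>_def)
    ultimately have "ennreal \<delta> * emeasure lborel (F b) \<le> emeasure lborel (F b \<inter> E b)"
      by (meson mult_right_mono order_trans zero_le)
    moreover have "emeasure lborel (F b \<inter> E b) \<noteq> \<infinity>"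
      using fin[of b] F[of b] emeasure_mono[of "F b \<inter> E b" "F b" lborel]
      by (auto simp: top_unique)
    moreover have "0 \<le> \<delta>" using tau_props(2)[OF l] by (simp add: \<delta>_def)
    ultimately have "\<delta> * measure lborel (F b) \<le> measure lborel (F b \<inter> E b)"
      using fin[of b] by (simp add: emeasure_eq_ennreal_measure ennreal_mult[symmetric])
    moreover have "measure lborel (F (Suc b)) = measure lborel (F b) - measure lborel (F b \<inter> E b)"
    proof -
      have "F (Suc b) = F b - F b \<inter> E b" by (auto simp: F_Suc)
      then show ?thesis by (simp, subst measure_Diff) (use fin[of b] F[of b] in auto)
    qed
    ultimately show ?thesis by (simp add: algebra_simps)
  qed
  have "1 \<le> tau l ^ (2 * k)"
    by (rule one_le_power) (use tau_props(2)[OF l] in simp)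
  then have \<delta>: "\<delta> \<le> 1"
    unfolding \<delta>_def by (subst divide_le_eq_1_pos) linarith+
  have pow: "measure lborel (F b) \<le> (1 - \<delta>) ^ b" for b
  proof (induction b)
    case 0
    show ?case by (simp add: F0 measure_def emeasure_irr)
  next
    case (Suc b)
    have "measure lborel (F (Suc b)) \<le> (1 - \<delta>) * (1 - \<delta>) ^ b"
      using step[of b] mult_left_mono[OF Suc, of "1 - \<delta>"] \<delta> by simp
    then show ?case by simp
  qed
  have sub: "{x \<in> irr. run_length n x l < k} \<subseteq> F b"
  proof
    fix x assume x: "x \<in> {x \<in> irr. run_length n x l < k}"
    have "digits (i * k) k x \<noteq> replicate k l" if "i < b" for i
    proof
      assume "digits (i * k) k x = replicate k l"
      moreover have "i * k + k \<le> n"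
        using that b by (metis Suc_leI add.commute mult_Suc mult_le_mono1 order_trans)
      ultimately have "k \<le> run_length n x l" using le_run_length_iff[OF k] by blast
      then show False using x by simp
    qed
    then show "x \<in> F b" using x by (simp add: F_def)
  qed
  have "emeasure lborel {x \<in> irr. run_length n x l < k} \<le> emeasure lborel (F b)"
    by (rule emeasure_mono[OF sub]) measurable
  also have "\<dots> = ennreal (measure lborel (F b))"
    using fin[of b] by (simp add: emeasure_eq_ennreal_measure)
  also have "\<dots> \<le> ennreal (exp (- (real b / (4 * tau l ^ (2 * k)))))"
  proof (rule ennreal_leI)
    have "measure lborel (F b) \<le> (1 - \<delta>) ^ b" by (rule pow)
    also have "\<dots> \<le> exp (- \<delta>) ^ b"
      using exp_ge_add_one_self[of "- \<delta>"] \<delta> by (intro power_mono) auto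
    also have "\<dots> = exp (- (real b / (4 * tau l ^ (2 * k))))"
      by (simp add: exp_of_nat_mult[symmetric] \<delta>_def)
    finally show "measure lborel (F b) \<le> \<dots>" .
  qed
  finally show ?thesis .
qed

section \<open>Almost sure asymptotics\<close>

lemma summable_exp_neg_powr:
  fixes C e :: real
  assumes "0 < C" "0 < e"
  shows "summable (\<lambda>m. exp (- (C * real m powr e)))"
proof (rule summable_comparison_test_ev)
  have "(\<lambda>m. exp (- (C * real m powr e))) \<in> o(\<lambda>m. real m powr - 2)"
    using assms by real_asymp
  from landau_o.smallD[OF this, of 1]
  show "\<forall>\<^sub>F m in sequentially. norm (exp (- (C * real m powr e))) \<le> real m powr - 2" by simp
qed (simp add: summable_real_powr_iff)

text \<open>The two logarithms are evaluated at opposite ends of the dyadic block, so that the value bounds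
  the level \<open>ln n / (2 a) - c ln (ln n) / a\<close> from above on the whole block.\<close>

definition lower_level :: "real \<Rightarrow> real \<Rightarrow> nat \<Rightarrow> real" where
  "lower_level a c m = ln (2 ^ Suc m) / (2 * a) - c * ln (ln (2 ^ m)) / a"

text \<open>The main term is m ln 2 / (2 a). Positivity makes the rounded level a valid run length,
  the second bound gives at least the order of 2^m / m blocks, and the third absorbs rounding in the
  number of blocks.\<close>

lemma lower_level_growth:
  assumes "0 < a"
  shows "\<forall>\<^sub>F m in sequentially. 0 < lower_level a c m"
    "\<forall>\<^sub>F m in sequentially. lower_level a c m + 1 \<le> real m / a"
    "\<forall>\<^sub>F m in sequentially. 2 * (lower_level a c m + 1) \<le> 2 ^ m"
proof -
  have eq: "ln (2 ^ m :: real) = real m * ln 2" for m :: nat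
    by (simp add: ln_realpow)
  show "\<forall>\<^sub>F m in sequentially. 0 < lower_level a c m"
    unfolding lower_level_def eq using assms by real_asymp
  show "\<forall>\<^sub>F m in sequentially. lower_level a c m + 1 \<le> real m / a"
    unfolding lower_level_def eq using assms by real_asymp
  show "\<forall>\<^sub>F m in sequentially. 2 * (lower_level a c m + 1) \<le> 2 ^ m"
    unfolding lower_level_def eq using assms by real_asymp
qed


lemma eventually_dyadic:
  assumes "\<forall>\<^sub>F m in sequentially. \<forall>n. 2 ^ m \<le> n \<and> n \<le> 2 ^ Suc m \<longrightarrow> P n"
  shows "\<forall>\<^sub>F n::nat in sequentially. P n"
proof -
  obtain M where M: "\<And>m n. M \<le> m \<Longrightarrow> 2 ^ m \<le> n \<Longrightarrow> n \<le> 2 ^ Suc m \<Longrightarrow> P n"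
    using assms by (auto simp: eventually_sequentially)
  have "P n" if n: "2 ^ M \<le> n" for n
  proof -
    have "1 \<le> (2 :: nat) ^ M" by simp
    with n have "1 \<le> n" by linarith
    then obtain m where m: "2 ^ m \<le> n" "n < 2 ^ (m + 1)"
      using ex_power_ivl1[of 2 n] by auto
    with n have "(2 :: nat) ^ M < 2 ^ (m + 1)" by linarith
    then have "M < m + 1" by (rule power_less_imp_less_exp[rotated]) simp
    then show ?thesis using M[of m n] m by auto
  qed
  then show ?thesis by (auto simp: eventually_sequentially)
qed

text \<open>\<open>1 \<le> m\<close> makes \<open>ln (2 ^ m)\<close> positive, where the outer
  logarithm is monotone.\<close>

lemma ln_ln_dyadic_bounds:
  fixes n m :: nat
  assumes "1 \<le> m" "2 ^ m \<le> n" "n \<le> 2 ^ Suc m"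
  shows "ln (2 ^ m) \<le> ln (real n)" "ln (real n) \<le> ln (2 ^ Suc m)"
    "ln (ln (2 ^ m)) \<le> ln (ln (real n))"
proof -
  have n: "2 ^ m \<le> real n" "real n \<le> 2 ^ Suc m"
    using assms(2,3) by (metis of_nat_le_iff of_nat_numeral of_nat_power)+
  have pos: "0 < (2 :: real) ^ m" "0 < ln ((2 :: real) ^ m)"
    using assms(1) by (simp_all add: ln_realpow)
  show *: "ln (2 ^ m) \<le> ln (real n)" using n pos by (intro ln_mono) auto
  have "0 < real n" using n pos by linarith
  then show "ln (real n) \<le> ln (2 ^ Suc m)" using n by (intro ln_mono) auto
  show "ln (ln (2 ^ m)) \<le> ln (ln (real n))" by (intro ln_mono *) (use * pos in linarith)+
qed

text \<open>The first Borel--Cantelli lemma. Lebesgue measure is infinite, so the events get finite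
  measure from lying in \<open>irr\<close>.\<close>

lemma AE_eventually_not:
  assumes sets: "\<And>m. {x \<in> irr. P m x} \<in> sets lborel"
    and bound: "\<forall>\<^sub>F m in sequentially. emeasure lborel {x \<in> irr. P m x} \<le> ennreal (g m)"
    and g: "summable g" "\<And>m. 0 \<le> g m"
  shows "AE x in lborel. x \<in> irr \<longrightarrow> (\<forall>\<^sub>F m in sequentially. \<not> P m x)"
proof -
  have fin: "emeasure lborel {x \<in> irr. P m x} < \<infinity>" for m
  proof -
    have "emeasure lborel {x \<in> irr. P m x} \<le> emeasure lborel irr"
      by (rule emeasure_mono) (use irrational_unit_borel in \<open>auto simp only: sets_lborel\<close>)
    also have "\<dots> < \<infinity>" by (simp only: emeasure_irr) simp
    finally show ?thesis .
  qed
  have "\<forall>\<^sub>F m in sequentially. norm (measure lborel {x \<in> irr. P m x}) \<le> g m"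
    using bound
  proof eventually_elim
    case (elim m)
    then show ?case using g(2)[of m] by (simp add: measure_def enn2real_leI)
  qed
  then have "summable (\<lambda>m. measure lborel {x \<in> irr. P m x})"
    using g(1) by (rule summable_comparison_test_ev)
  from borel_cantelli_AE1[OF sets fin this] show ?thesis
    by eventually_elim (auto elim: eventually_mono)
qed

text \<open>Serves runs of a fixed letter and maximal runs alike. On a dyadic block \<open>f\<close>
  is largest at the right end and the level smallest at the left end, so one event per block
  suffices; its probability is of order m^(-2c), summable as 2c > 1.\<close>

lemma AE_eventually_le:
  fixes f :: "nat \<Rightarrow> real \<Rightarrow> nat"
  assumes a: "0 < a" and c: "1 / 2 < c"
    and mono: "\<And>m n x. m \<le> n \<Longrightarrow> f m x \<le> f n x"
    and sets: "\<And>n k. {x \<in> irr. k \<le> f n x} \<in> sets lborel"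
    and bound: "\<And>n k. 2 \<le> k \<Longrightarrow>
      emeasure lborel {x \<in> irr. k \<le> f n x} \<le> ennreal (C * real n / exp (2 * a * real k))"
    and C: "0 \<le> C"
  shows "AE x in lborel. x \<in> irr \<longrightarrow>
    (\<forall>\<^sub>F n in sequentially. real (f n x) \<le> ln (real n) / (2 * a) + c * ln (ln (real n)) / a)"
proof -
  define K where "K m = ln (2 ^ m) / (2 * a) + c * ln (ln (2 ^ m)) / a" for m :: nat
  \<comment> \<open>The least integer strictly above \<open>K m\<close>: staying below it means
    staying at most \<open>K m\<close>.\<close>
  define k where "k m = nat (\<lfloor>K m\<rfloor> + 1)" for m
  have ln_pow: "ln (2 ^ m :: real) = real m * ln 2" for m :: nat
    by (simp add: ln_realpow)
  have K_large: "\<forall>\<^sub>F m in sequentially. 1 \<le> K m"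
    unfolding K_def ln_pow using a c by real_asymp
  \<comment> \<open>In C 2^(m+1) / exp(2 a K m) the powers of 2 cancel up to a factor 2, leaving (m
    ln 2)^(-2c).\<close>
  define g where "g m = 2 * C * ln 2 powr (- 2 * c) * real m powr (- 2 * c)" for m :: nat
  have meas: "emeasure lborel {x \<in> irr. k m \<le> f (2 ^ Suc m) x} \<le> ennreal (g m)"
    if K1: "1 \<le> K m" and m: "1 \<le> m" for m
  proof -
    have k2: "2 \<le> k m" using K1 unfolding k_def by linarith
    have Kk: "K m \<le> real (k m)" unfolding k_def by linarith
    have "2 * a * K m = ln (2 ^ m) + 2 * c * ln (ln (2 ^ m))"
      using a by (simp add: K_def field_simps)
    moreover have "exp (real m * ln 2) = 2 ^ m" by (simp add: exp_of_nat_mult)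
    ultimately have "exp (2 * a * K m) = 2 ^ m * (real m * ln 2) powr (2 * c)"
      using m by (simp add: exp_add powr_def ln_pow)
    also have "\<dots> = 2 ^ m * (ln 2 powr (2 * c) * real m powr (2 * c))"
      by (simp add: powr_mult)
    finally have e: "exp (2 * a * K m) = \<dots>" .
    have "C * real (2 ^ Suc m) / exp (2 * a * real (k m)) \<le> C * real (2 ^ Suc m) / exp (2 * a * K m)"
      using C a Kk by (intro divide_left_mono) auto
    also have "\<dots> = g m"
      unfolding e g_def by (simp add: powr_minus field_simps)
    finally show ?thesis
      using bound[OF k2, of "2 ^ Suc m"] by (meson ennreal_leI order_trans)
  qed
  have "AE x in lborel. x \<in> irr \<longrightarrow> (\<forall>\<^sub>F m in sequentially. \<not> k m \<le> f (2 ^ Suc m) x)"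
  proof (rule AE_eventually_not[OF sets])
    show "\<forall>\<^sub>F m in sequentially. emeasure lborel {x \<in> irr. k m \<le> f (2 ^ Suc m) x} \<le> ennreal (g m)"
      using K_large eventually_ge_at_top[of 1] by eventually_elim (rule meas)
    show "summable g"
      unfolding g_def using c by (intro summable_mult) (simp add: summable_real_powr_iff)
    show "0 \<le> g m" for m using C by (simp add: g_def)
  qed
  then show ?thesis
  proof eventually_elim
    case (elim x)
    show ?case
    proof
      assume "x \<in> irr"
      with elim have "\<forall>\<^sub>F m in sequentially. \<not> k m \<le> f (2 ^ Suc m) x" by blast
      with K_large eventually_ge_at_top[of 1]
      have "\<forall>\<^sub>F m in sequentially. \<forall>n. 2 ^ m \<le> n \<and> n \<le> 2 ^ Suc m \<longrightarrow>
          real (f n x) \<le> ln (real n) / (2 * a) + c * ln (ln (real n)) / a"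
      proof eventually_elim
        case m: (elim m)
        show ?case
        proof (intro allI impI, elim conjE)
          fix n :: nat
          assume n: "2 ^ m \<le> n" "n \<le> 2 ^ Suc m"
          have "real (f n x) \<le> real (f (2 ^ Suc m) x)" using mono[OF n(2)] by simp
          also have "\<dots> \<le> K m" using m(1,3) unfolding k_def by linarith
          also have "\<dots> \<le> ln (real n) / (2 * a) + c * ln (ln (real n)) / a"
            unfolding K_def using ln_ln_dyadic_bounds[OF m(2) n] a c
            by (intro add_mono divide_right_mono mult_left_mono) auto
          finally show "real (f n x) \<le> ln (real n) / (2 * a) + c * ln (ln (real n)) / a" .
        qed
      qed
      then show "\<forall>\<^sub>F n in sequentially. real (f n x) \<le> ln (real n) / (2 * a) + c * ln (ln (real n)) / a"
        by (rule eventually_dyadic)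
    qed
  qed
qed

lemma tau_power_eq_exp:
  assumes "1 \<le> l"
  shows "tau l ^ (2 * k) = exp (2 * ln (tau l) * real k)"
proof -
  have "exp (2 * ln (tau l) * real k) = exp (real (2 * k) * ln (tau l))" by simp
  also have "\<dots> = exp (ln (tau l)) ^ (2 * k)" by (rule exp_of_nat_mult)
  finally show ?thesis using tau_props(2)[OF assms] by simp
qed

text \<open>About 2^m / m blocks, each successful with probability of order m^(2c) / 2^m, all fail
  with probability at most exp(- C m^(2c - 1)). This is summable because 2c - 1 > 0, and
  monotonicity carries the run found at 2^m through the dyadic block.\<close>

lemma AE_eventually_run_length_ge:
  assumes l: "1 \<le> l" and c: "1 / 2 < c"
  shows "AE x in lborel. x \<in> irr \<longrightarrow> (\<forall>\<^sub>F n in sequentially.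
    ln (real n) / (2 * ln (tau l)) - c * ln (ln (real n)) / ln (tau l) \<le> real (run_length n x l))"
proof -
  define a where "a = ln (tau l)"
  have t: "1 < tau l" using tau_props(2)[OF l] .
  have a: "0 < a" using t by (simp add: a_def)
  have tau_pow: "tau l ^ (2 * k) = exp (2 * a * real k)" for k
    unfolding a_def by (rule tau_power_eq_exp[OF l])
  let ?J = "lower_level a c"
  define k where "k m = nat \<lceil>?J m\<rceil>" for m
  \<comment> \<open>16 = 2 * 2 * 4: rounding the number of blocks, 2^(m+1) in
    \<open>lower_level\<close>, and the 4 of \<open>emeasure_no_run_le\<close>. The factor exp(2 a)
    pays for rounding the level up to \<open>k m\<close>.\<close>
  define C where "C = a * ln 2 powr (2 * c) / (16 * exp (2 * a))"
  have C: "0 < C" using a by (simp add: C_def)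
  define g where "g m = exp (- (C * real m powr (2 * c - 1)))" for m :: nat
  have meas: "emeasure lborel {x \<in> irr. run_length (2 ^ m) x l < k m} \<le> ennreal (g m)"
    if J: "0 < ?J m" "?J m + 1 \<le> real m / a" "2 * (?J m + 1) \<le> 2 ^ m" and m: "1 \<le> m" for m
  proof -
    define b where "b = 2 ^ m div k m"
    have k1: "1 \<le> k m" using J(1) unfolding k_def by linarith
    have kJ: "real (k m) \<le> ?J m + 1" using J(1) unfolding k_def by linarith
    have "b * k m \<le> 2 ^ m" by (simp add: b_def)
    note no_run = emeasure_no_run_le[OF l k1 this]
    have "(2 :: nat) ^ m < (b + 1) * k m"
      using dividend_less_div_times[of "k m" "2 ^ m"] k1 by (simp add: b_def)
    then have "(2 :: real) ^ m < (real b + 1) * real (k m)"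
      by (metis of_nat_1 of_nat_add of_nat_less_iff of_nat_mult of_nat_numeral of_nat_power)
    also have "\<dots> \<le> (real b + 1) * (?J m + 1)"
      using kJ by (intro mult_left_mono) auto
    finally have "2 ^ m < real b * (?J m + 1) + (?J m + 1)" by (simp add: algebra_simps)
    moreover have "real b * (?J m + 1) \<le> real b * (real m / a)"
      using J(2) by (intro mult_left_mono) auto
    \<comment> \<open>The remainder \<open>?J m + 1\<close> is at most half of 2^m and is absorbed
      into the left side.\<close>
    ultimately have "2 ^ m \<le> 2 * (real b * (real m / a))" using J(3) by argo
    then have b: "a * 2 ^ m / (2 * real m) \<le> real b"
      using a m by (simp add: field_simps)
    have "2 * a * (?J m + 1) = ln (2 ^ Suc m) - 2 * c * ln (ln (2 ^ m)) + 2 * a"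
      using a by (simp add: lower_level_def field_simps)
    then have "exp (2 * a * (?J m + 1)) = 2 ^ Suc m / (real m * ln 2) powr (2 * c) * exp (2 * a)"
      using m by (simp add: exp_add exp_diff powr_def ln_realpow)
    also have "\<dots> = 2 ^ Suc m * exp (2 * a) / (real m powr (2 * c) * ln 2 powr (2 * c))"
      by (simp add: powr_mult)
    finally have e: "exp (2 * a * (?J m + 1)) = \<dots>" .
    have "C * real m powr (2 * c - 1) = (a * 2 ^ m / (2 * real m)) / (4 * exp (2 * a * (?J m + 1)))"
      unfolding e C_def using m by (simp add: powr_diff field_simps)
    also have "\<dots> \<le> real b / (4 * exp (2 * a * (?J m + 1)))"
      by (intro divide_right_mono b) simp
    also have "\<dots> \<le> real b / (4 * tau l ^ (2 * k m))"
      unfolding tau_pow using kJ a by (intro divide_left_mono) auto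
    finally have "exp (- (real b / (4 * tau l ^ (2 * k m)))) \<le> g m"
      by (simp add: g_def)
    then show ?thesis using no_run by (meson ennreal_leI order_trans)
  qed
  have sets: "{x \<in> irr. run_length (2 ^ m) x l < k m} \<in> sets lborel" for m
  proof -
    have "{x \<in> irr. run_length (2 ^ m) x l < k m} = irr - {x \<in> irr. k m \<le> run_length (2 ^ m) x l}"
      by auto
    also have "\<dots> \<in> sets lborel"
      using irrational_unit_borel sets_run_length by (metis sets.Diff sets_lborel)
    finally show ?thesis .
  qed
  have "AE x in lborel. x \<in> irr \<longrightarrow> (\<forall>\<^sub>F m in sequentially. \<not> run_length (2 ^ m) x l < k m)"
  proof (rule AE_eventually_not[OF sets])
    show "\<forall>\<^sub>F m in sequentially. emeasure lborel {x \<in> irr. run_length (2 ^ m) x l < k m} \<le> ennreal (g m)"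
      using lower_level_growth[OF a, of c] eventually_ge_at_top[of 1] by eventually_elim (rule meas)
    show "summable g" unfolding g_def using C c by (intro summable_exp_neg_powr) auto
    show "0 \<le> g m" for m by (simp add: g_def)
  qed
  then show ?thesis
    unfolding a_def[symmetric]
  proof eventually_elim
    case (elim x)
    show ?case
    proof
      assume "x \<in> irr"
      with elim have "\<forall>\<^sub>F m in sequentially. \<not> run_length (2 ^ m) x l < k m" by blast
      with eventually_ge_at_top[of 1]
      have "\<forall>\<^sub>F m in sequentially. \<forall>n. 2 ^ m \<le> n \<and> n \<le> 2 ^ Suc m \<longrightarrow>
          ln (real n) / (2 * a) - c * ln (ln (real n)) / a \<le> real (run_length n x l)"
      proof eventually_elim
        case m: (elim m)
        show ?case
        proof (intro allI impI, elim conjE)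
          fix n :: nat
          assume n: "2 ^ m \<le> n" "n \<le> 2 ^ Suc m"
          have "ln (real n) / (2 * a) - c * ln (ln (real n)) / a \<le> ?J m"
            unfolding lower_level_def using ln_ln_dyadic_bounds[OF m(1) n] a c
            by (intro diff_mono divide_right_mono mult_left_mono) auto
          also have "\<dots> \<le> real (run_length (2 ^ m) x l)" using m(2) unfolding k_def by linarith
          also have "\<dots> \<le> real (run_length n x l)" using run_length_mono[OF n(1)] by simp
          finally show "ln (real n) / (2 * a) - c * ln (ln (real n)) / a \<le> real (run_length n x l)" .
        qed
      qed
      then show "\<forall>\<^sub>F n in sequentially.
          ln (real n) / (2 * a) - c * ln (ln (real n)) / a \<le> real (run_length n x l)"
        by (rule eventually_dyadic)
    qed
  qed
qed

section \<open>The two-sided almost sure bounds\<close>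

theorem theorem2:
  fixes l :: nat and c :: real
  assumes "l \<ge> 1" and "c > 1 / 2"
  shows "AE x in gauss_measure. \<exists>N. \<forall>n\<ge>N.
           \<bar>real (run_length n x l) - ln (real n) / (2 * ln (tau l))\<bar>
             \<le> c * ln (ln (real n)) / ln (tau l) \<and>
           \<bar>real (max_run_length n x) - ln (real n) / (2 * ln golden_ratio)\<bar>
             \<le> c * ln (ln (real n)) / ln golden_ratio"
proof -
  have golden: "golden_ratio = tau 1" by (simp add: golden_ratio_def tau_def)
  have log_pos: "0 < ln (tau i)" if "1 \<le> i" for i using tau_props(2)[OF that] by simp
  have run_upper: "AE x in lborel. x \<in> irr \<longrightarrow> (\<forall>\<^sub>F n in sequentially.
      real (run_length n x l) \<le> ln (real n) / (2 * ln (tau l)) + c * ln (ln (real n)) / ln (tau l))"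
  proof (rule AE_eventually_le[where C = "2 * tau l ^ 2"])
    show "emeasure lborel {x \<in> irr. k \<le> run_length n x l}
        \<le> ennreal (2 * tau l ^ 2 * real n / exp (2 * ln (tau l) * real k))" if "2 \<le> k" for n k
      unfolding tau_power_eq_exp[OF assms(1), symmetric]
      using emeasure_run_length_le[OF assms(1), of k n] that by (simp add: mult_ac)
  qed (use assms log_pos run_length_mono sets_run_length in auto)
  obtain C where C: "0 \<le> C" "\<And>n k. 2 \<le> k \<Longrightarrow>
      emeasure lborel {x \<in> irr. k \<le> max_run_length n x} \<le> ennreal (C * real n / tau 1 ^ (2 * k))"
    by (rule emeasure_max_run_length_le) blast
  have max_upper: "AE x in lborel. x \<in> irr \<longrightarrow> (\<forall>\<^sub>F n in sequentially.
      real (max_run_length n x) \<le> ln (real n) / (2 * ln (tau 1)) + c * ln (ln (real n)) / ln (tau 1))"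
  proof (rule AE_eventually_le[where C = C])
    show "emeasure lborel {x \<in> irr. k \<le> max_run_length n x}
        \<le> ennreal (C * real n / exp (2 * ln (tau 1) * real k))" if "2 \<le> k" for n k
      using C(2)[OF that, of n] by (simp only: tau_power_eq_exp[OF order_refl])
  qed (use assms C log_pos max_run_length_mono sets_max_run_length in auto)
  have "AE x in lborel. x \<in> irr \<longrightarrow> (\<exists>N. \<forall>n\<ge>N.
      \<bar>real (run_length n x l) - ln (real n) / (2 * ln (tau l))\<bar> \<le> c * ln (ln (real n)) / ln (tau l) \<and>
      \<bar>real (max_run_length n x) - ln (real n) / (2 * ln golden_ratio)\<bar>
        \<le> c * ln (ln (real n)) / ln golden_ratio)"
    using run_upper max_upper AE_eventually_run_length_ge[OF assms]
      AE_eventually_run_length_ge[OF order_refl assms(2)]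
  proof eventually_elim
    case (elim x)
    show ?case
    proof
      assume "x \<in> irr"
      with elim have "\<forall>\<^sub>F n in sequentially.
          real (run_length n x l) \<le> ln (real n) / (2 * ln (tau l)) + c * ln (ln (real n)) / ln (tau l)"
        "\<forall>\<^sub>F n in sequentially.
          real (max_run_length n x) \<le> ln (real n) / (2 * ln (tau 1)) + c * ln (ln (real n)) / ln (tau 1)"
        "\<forall>\<^sub>F n in sequentially.
          ln (real n) / (2 * ln (tau l)) - c * ln (ln (real n)) / ln (tau l) \<le> real (run_length n x l)"
        "\<forall>\<^sub>F n in sequentially.
          ln (real n) / (2 * ln (tau 1)) - c * ln (ln (real n)) / ln (tau 1) \<le> real (run_length n x 1)"
        by blast+
      then have "\<forall>\<^sub>F n in sequentially.
          \<bar>real (run_length n x l) - ln (real n) / (2 * ln (tau l))\<bar> \<le> c * ln (ln (real n)) / ln (tau l) \<and>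
          \<bar>real (max_run_length n x) - ln (real n) / (2 * ln golden_ratio)\<bar>
            \<le> c * ln (ln (real n)) / ln golden_ratio"
      proof eventually_elim
        case (elim n)
        \<comment> \<open>Runs of ones supply the lower bound for the maximum, since
          \<open>golden_ratio\<close> is \<open>tau 1\<close>.\<close>
        have "real (run_length n x 1) \<le> real (max_run_length n x)"
          using run_length_le_max_run_length[of 1 n x] by simp
        with elim show ?case unfolding golden by linarith
      qed
      then show "\<exists>N. \<forall>n\<ge>N.
          \<bar>real (run_length n x l) - ln (real n) / (2 * ln (tau l))\<bar> \<le> c * ln (ln (real n)) / ln (tau l) \<and>
          \<bar>real (max_run_length n x) - ln (real n) / (2 * ln golden_ratio)\<bar>
            \<le> c * ln (ln (real n)) / ln golden_ratio"
        by (simp only: eventually_sequentially)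
    qed
  qed
  then show ?thesis unfolding AE_gauss_measure_iff .
qed

end
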